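(* Let $X$ be a Hausdorff topological space and let $A$ be a nonempty subset of $X$ which is both an $F_\sigma$-subset and a $G_\delta$-subset of $X$. Then there exists a linear operator $T\colon\mathfrak{fcBor}(A,\mathbb{R})\to\mathfrak{fcBor}(X,\mathbb{R})$ which is an extension operator, i.e. $T(f)(a)=f(a)$ for every $f\in\mathfrak{fcBor}(A,\mathbb{R})$ and every $a\in A$, and whose restriction to $\mathfrak{fcBor}^b(A,\mathbb{R})$ is an isometry for the supremum norms, i.e. $\|T(f)\|_X=\|f\|_A$ for every $f\in\mathfrak{fcBor}^b(A,\mathbb{R})$.
   Context: For topological spaces $X,Y$, a function $f\colon X\to Y$ is of the first Borel class if $f^{-1}(U)$ is an $F_\sigma$-subset of $X$ (a countable union of closed sets) for every open $U\subset Y$. The family of all such functions is denoted $\mathfrak{fcBor}(X,Y)$. For a subset $A\subset X$, $\mathfrak{fcBor}(A,Y)$ is defined in the same way with $A$ carrying the subspace topology. $\mathfrak{fcBor}^b(A,\mathbb{R})$ denotes the bounded elements of $\mathfrak{fcBor}(A,\mathbb{R})$, and $\|f\|_A=\sup_{x\in A}|f(x)|$ (similarly $\|\cdot\|_X$). Real-valued functions are added and scaled pointwise. *)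

theory Defs
  imports "HOL-Analysis.Analysis"
begin

text \<open>
  A function on a space \<open>X\<close> is represented by an extensional function, i.e. one taking the
  value \<open>undefined\<close> outside \<open>topspace X\<close>. Thus equality of representatives is equality of
  functions on \<open>X\<close>, and an operator between function spaces is simply a function on these sets.
\<close>

definition fcBor :: "'a topology \<Rightarrow> 'b topology \<Rightarrow> ('a \<Rightarrow> 'b) set" where
  "fcBor X Y = {f \<in> topspace X \<rightarrow>\<^sub>E topspace Y.
     \<forall>U. openin Y U \<longrightarrow> fsigma_in X {x \<in> topspace X. f x \<in> U}}"

definition fcBor_bounded :: "'a topology \<Rightarrow> ('a \<Rightarrow> real) set" where
  "fcBor_bounded X = {f \<in> fcBor X euclideanreal. bounded (f ` topspace X)}"

text \<open>
  The supremum is taken in the reals, so \<open>sup_norm S f\<close> is meaningful only for nonempty \<open>S\<close> and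
  \<open>f\<close> bounded on \<open>S\<close>.
\<close>

definition sup_norm :: "'a set \<Rightarrow> ('a \<Rightarrow> real) \<Rightarrow> real" where
  "sup_norm S f = (SUP x\<in>S. \<bar>f x\<bar>)"

definition fun_add :: "'a set \<Rightarrow> ('a \<Rightarrow> real) \<Rightarrow> ('a \<Rightarrow> real) \<Rightarrow> 'a \<Rightarrow> real" where
  "fun_add S f g = (\<lambda>x\<in>S. f x + g x)"

definition fun_scale :: "'a set \<Rightarrow> real \<Rightarrow> ('a \<Rightarrow> real) \<Rightarrow> 'a \<Rightarrow> real" where
  "fun_scale S c f = (\<lambda>x\<in>S. c * f x)"

definition fcBor_linear_operator ::
    "'a topology \<Rightarrow> 'b topology \<Rightarrow> (('a \<Rightarrow> real) \<Rightarrow> ('b \<Rightarrow> real)) \<Rightarrow> bool" where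
  "fcBor_linear_operator X Y T \<longleftrightarrow>
     T \<in> fcBor X euclideanreal \<rightarrow> fcBor Y euclideanreal \<and>
     (\<forall>f \<in> fcBor X euclideanreal. \<forall>g \<in> fcBor X euclideanreal.
        T (fun_add (topspace X) f g) = fun_add (topspace Y) (T f) (T g)) \<and>
     (\<forall>c. \<forall>f \<in> fcBor X euclideanreal.
        T (fun_scale (topspace X) c f) = fun_scale (topspace Y) c (T f))"

end

theory Submission
  imports Defs
begin

text \<open>
  The operator \<open>T\<close> is extension by zero. It is plainly linear, and, as \<open>A\<close> is nonempty and \<open>\<bar>f\<bar> \<ge> 0\<close>,
  new values \<open>0\<close> do not change the supremum of \<open>\<bar>f\<bar>\<close>. The point is that \<open>T f\<close> is again of the first
  Borel class: the preimage of an open set \<open>U\<close> under \<open>T f\<close> is the preimage under \<open>f\<close>,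
  together with \<open>X - A\<close> when \<open>0 \<in> U\<close>. The former is \<open>F\<^sub>\<sigma>\<close> in \<open>A\<close>, hence in \<open>X\<close> because \<open>A\<close> is \<open>F\<^sub>\<sigma>\<close>;
  the latter is \<open>F\<^sub>\<sigma>\<close> because \<open>A\<close> is \<open>G\<^sub>\<delta>\<close>.
\<close>

text \<open>
  Extension by zero of a function on \<open>A\<close> to the set \<open>S\<close>, intended for \<open>A \<subseteq> S\<close>; the result is
  extensional, that is, \<open>undefined\<close> outside \<open>S\<close>.
\<close>

definition zero_extension :: "'a set \<Rightarrow> 'a set \<Rightarrow> ('a \<Rightarrow> real) \<Rightarrow> 'a \<Rightarrow> real" where
  "zero_extension S A f = (\<lambda>x\<in>S. if x \<in> A then f x else 0)"

lemma zero_extension_add: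
  "zero_extension S A (fun_add A f g) = fun_add S (zero_extension S A f) (zero_extension S A g)"
  by (auto simp: zero_extension_def fun_add_def)

lemma zero_extension_scale:
  "zero_extension S A (fun_scale A c f) = fun_scale S c (zero_extension S A f)"
  by (auto simp: zero_extension_def fun_scale_def)

lemma zero_extension_in_fcBor:
  assumes A: "fsigma_in X A" "gdelta_in X A"
    and f: "f \<in> fcBor (subtopology X A) euclideanreal"
  shows "zero_extension (topspace X) A f \<in> fcBor X euclideanreal"
proof -
  have AX: "A \<subseteq> topspace X" using A(1) by (rule fsigma_in_subset)
  have "fsigma_in X {x \<in> topspace X. zero_extension (topspace X) A f x \<in> U}"
    if "open U" for U
  proof -
    have "fsigma_in (subtopology X A) {x \<in> A. f x \<in> U}"
      using f that unfolding fcBor_def topspace_subtopology_subset[OF AX] by simp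
    then have in_A: "fsigma_in X {x \<in> A. f x \<in> U}"
      using A(1) by (simp add: fsigma_in_fsigma_subtopology)
    have compl: "fsigma_in X (topspace X - A)"
      using A(2) by (simp add: gdelta_in_fsigma_in)
    have "{x \<in> topspace X. zero_extension (topspace X) A f x \<in> U}
        = {x \<in> A. f x \<in> U} \<union> (if 0 \<in> U then topspace X - A else {})"
      using AX by (auto simp: zero_extension_def)
    then show ?thesis
      using in_A compl by (simp add: fsigma_in_Un)
  qed
  then show ?thesis
    by (simp add: fcBor_def zero_extension_def)
qed

lemma zero_extension_image_subset:
  "zero_extension S A f ` S \<subseteq> insert 0 (f ` A)"
  by (auto simp: zero_extension_def)

lemma sup_norm_zero_extension:
  assumes "A \<noteq> {}" "A \<subseteq> S" and bdd: "bounded (f ` A)"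
  shows "sup_norm S (zero_extension S A f) = sup_norm A f"
proof -
  let ?g = "zero_extension S A f"
  have bdd_A: "bdd_above ((\<lambda>x. \<bar>f x\<bar>) ` A)"
    using bdd by (auto simp: bounded_iff bdd_above_def)
  have f_le: "\<bar>f x\<bar> \<le> sup_norm A f" if "x \<in> A" for x
    unfolding sup_norm_def using bdd_A that by (rule cSUP_upper2) simp
  \<comment> \<open>nonnegativity of the supremum needs a point of \<open>A\<close>\<close>
  have nonneg: "0 \<le> sup_norm A f"
    using \<open>A \<noteq> {}\<close> f_le by (meson abs_ge_zero ex_in_conv order_trans)
  have g_le: "\<bar>?g x\<bar> \<le> sup_norm A f" if "x \<in> S" for x
    using that f_le nonneg by (simp add: zero_extension_def)
  have bdd_S: "bdd_above ((\<lambda>x. \<bar>?g x\<bar>) ` S)"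
    using g_le by (auto simp: bdd_above_def)
  show ?thesis
  proof (rule antisym)
    show "sup_norm S ?g \<le> sup_norm A f"
      unfolding sup_norm_def[of S] using assms g_le by (intro cSUP_least) auto
    show "sup_norm A f \<le> sup_norm S ?g"
      unfolding sup_norm_def
      using assms bdd_S by (intro cSUP_mono) (auto simp: zero_extension_def)
  qed
qed

theorem theorem4:
  fixes X :: "'a topology" and A :: "'a set"
  assumes "Hausdorff_space X"
    and "A \<noteq> {}"
    and "fsigma_in X A"
    and "gdelta_in X A"
  shows "\<exists>T :: ('a \<Rightarrow> real) \<Rightarrow> ('a \<Rightarrow> real).
    fcBor_linear_operator (subtopology X A) X T \<and>
    (\<forall>f \<in> fcBor (subtopology X A) euclideanreal. \<forall>a \<in> A. T f a = f a) \<and>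
    (\<forall>f \<in> fcBor_bounded (subtopology X A).
       T f \<in> fcBor_bounded X \<and> sup_norm (topspace X) (T f) = sup_norm A f)"
proof (intro exI conjI ballI)
  let ?T = "zero_extension (topspace X) A"
  have AX: "A \<subseteq> topspace X" using assms(3) by (rule fsigma_in_subset)
  then have top_A: "topspace (subtopology X A) = A" by (rule topspace_subtopology_subset)
  note T_fcBor = zero_extension_in_fcBor[OF assms(3,4)]
  show "fcBor_linear_operator (subtopology X A) X ?T"
    unfolding fcBor_linear_operator_def top_A
    using T_fcBor by (simp add: zero_extension_add zero_extension_scale)
  show "?T f a = f a" if "a \<in> A" for f a
    using that AX by (auto simp: zero_extension_def)
  fix f assume "f \<in> fcBor_bounded (subtopology X A)"
  then have f: "f \<in> fcBor (subtopology X A) euclideanreal" and bdd: "bounded (f ` A)"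
    unfolding fcBor_bounded_def top_A by simp_all
  have "bounded (?T f ` topspace X)"
    using bdd zero_extension_image_subset by (rule bounded_subset[OF bounded_insert[THEN iffD2]])
  then show "?T f \<in> fcBor_bounded X"
    using T_fcBor[OF f] by (simp add: fcBor_bounded_def)
  show "sup_norm (topspace X) (?T f) = sup_norm A f"
    using assms(2) AX bdd by (rule sup_norm_zero_extension)
qed

end
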